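(* Let $G$ be a nonempty graph of order $n$, and let $k$ be an integer with $1\le k\le n$. Then $\mathrm{str}(G)\leq 2n-k$ if and only if the complement $\overline{G}$ contains $F_k$ as a subgraph.
   Context: All graphs are finite and simple; a graph is nonempty if it has at least one edge. Subgraphs are not necessarily induced. A numbering of a graph $G$ of order $n$ is a bijection $g:V(G)\to\{1,\dots,n\}$. For a nonempty graph $G$, $\mathrm{str}_g(G)=\max\{g(u)+g(v) : uv\in E(G)\}$, and the strength of $G$ is $\mathrm{str}(G)=\min\{\mathrm{str}_g(G) : g \text{ is a numbering of } G\}$. Let $F_1=K_1$, and for integers $k\geq 2$ let $F_k$ be the graph with vertex set $\{v_i : 1\le i\le k\}$ and edge set $\{v_iv_j : 1\le i\le \lfloor k/2\rfloor,\ i+1\le j\le k+1-i\}$. *)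

theory Defs
  imports "Graph_Theory.Pair_Digraph" "Graph_Theory.Digraph_Isomorphism"
begin

text \<open>
  A finite simple graph is a \<^locale>\<open>pair_graph\<close>: a finite, symmetric, loop-free digraph
  without parallel arcs.  An undirected edge \<open>uv\<close> is the pair of arcs \<open>(u, v)\<close>, \<open>(v, u)\<close>.
\<close>

definition numbering :: "'a pair_pre_digraph \<Rightarrow> ('a \<Rightarrow> nat) \<Rightarrow> bool" where
  "numbering G g \<longleftrightarrow> bij_betw g (pverts G) {1..card (pverts G)}"

text \<open>
  Only meaningful if \<open>G\<close> has an edge, since otherwise \<^const>\<open>Max\<close> is applied to the empty set.
\<close>
definition numbering_strength :: "'a pair_pre_digraph \<Rightarrow> ('a \<Rightarrow> nat) \<Rightarrow> nat" where
  "numbering_strength G g = Max {g u + g v | u v. (u, v) \<in> parcs G}"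

definition strength :: "'a pair_pre_digraph \<Rightarrow> nat" where
  "strength G = Min {numbering_strength G g | g. numbering G g}"

definition complement :: "'a pair_pre_digraph \<Rightarrow> 'a pair_pre_digraph" where
  "complement G = \<lparr> pverts = pverts G,
     parcs = {(u, v). u \<in> pverts G \<and> v \<in> pverts G \<and> u \<noteq> v \<and> (u, v) \<notin> parcs G} \<rparr>"

definition F_edges :: "nat \<Rightarrow> nat rel" where
  "F_edges k = {(i, j). 1 \<le> i \<and> i \<le> k div 2 \<and> i + 1 \<le> j \<and> j \<le> k + 1 - i}"

text \<open>
  The vertex \<open>v\<^sub>i\<close> is the number \<open>i\<close>.  The separate clause \<open>F\<^sub>1 = K\<^sub>1\<close> is an instance of the
  general formula, see \<open>F_graph_1\<close> below.
\<close>
definition F_graph :: "nat \<Rightarrow> nat pair_pre_digraph" where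
  "F_graph k = \<lparr> pverts = {1..k}, parcs = F_edges k \<union> (F_edges k)\<inverse> \<rparr>"

text \<open>
  Containment is up to isomorphism; the copy \<open>H\<close> of \<open>F\<close> in \<open>G\<close> need not be induced.
\<close>
definition contains_graph :: "'a pair_pre_digraph \<Rightarrow> 'b pair_pre_digraph \<Rightarrow> bool" where
  "contains_graph G F \<longleftrightarrow>
     (\<exists>H :: 'a pair_pre_digraph. pair_graph H \<and> subgraph H G \<and> digraph_iso F H)"

lemma F_graph_1: "F_graph 1 = \<lparr> pverts = {1}, parcs = {} \<rparr>"
  by (auto simp: F_graph_def F_edges_def)

lemma pair_graph_F_graph: "pair_graph (F_graph k)"
proof -
  have "F_edges k \<union> (F_edges k)\<inverse> \<subseteq> {1..k} \<times> {1..k}"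
    by (auto simp: F_edges_def)
  then have "finite (F_edges k \<union> (F_edges k)\<inverse>)"
    by (rule finite_subset) auto
  then show ?thesis
    by unfold_locales (auto simp: F_graph_def F_edges_def symmetric_def intro!: symI)
qed

lemma pair_graph_complement:
  assumes "pair_graph G"
  shows "pair_graph (complement G)"
proof -
  interpret pair_graph G by fact
  have "finite (parcs (complement G))"
    by (rule finite_subset[of _ "pverts G \<times> pverts G"])
      (auto simp: complement_def pair_finite_verts)
  moreover have "sym (parcs G)"
    using pair_sym_arcs by (simp add: symmetric_def)
  ultimately show ?thesis
    by unfold_locales
      (auto simp: complement_def pair_finite_verts symmetric_def intro!: symI dest: symD)
qed

text \<open>
  There are infinitely many numberings, since their values outside \<open>pverts G\<close> are arbitrary;
  the set of their strengths is nevertheless finite, so that \<^const>\<open>Min\<close> in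
  \<open>strength\<close> is a genuine minimum.
\<close>
lemma strength_attained:
  assumes "pair_graph G" and "parcs G \<noteq> {}"
  shows "\<exists>g. numbering G g \<and> strength G = numbering_strength G g"
    and "numbering G g \<Longrightarrow> strength G \<le> numbering_strength G g"
proof -
  interpret pair_graph G by fact
  let ?S = "{numbering_strength G g | g. numbering G g}"
  have "numbering_strength G g \<le> 2 * card (pverts G)" if "numbering G g" for g
  proof -
    have le: "g u \<le> card (pverts G)" if "u \<in> pverts G" for u
      using \<open>numbering G g\<close> that bij_betwE unfolding numbering_def by fastforce
    have eq: "{g u + g v | u v. (u, v) \<in> parcs G} = (\<lambda>(u, v). g u + g v) ` parcs G"
      by auto
    have "g u + g v \<le> 2 * card (pverts G)" if "(u, v) \<in> parcs G" for u v
      using le[of u] le[of v] in_arcsD1[OF that] in_arcsD2[OF that] by simp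
    then show ?thesis
      unfolding numbering_strength_def eq using pair_finite_arcs assms(2) by auto
  qed
  then have "?S \<subseteq> {..2 * card (pverts G)}"
    by auto
  then have fin: "finite ?S"
    by (rule finite_subset) simp
  obtain g0 where "bij_betw g0 (pverts G) {1..card (pverts G)}"
    using pair_finite_verts ex_bij_betw_finite_nat
    by (metis card_atLeastAtMost diff_Suc_1 finite_atLeastAtMost finite_same_card_bij)
  then have "?S \<noteq> {}"
    by (auto simp: numbering_def)
  then have "strength G \<in> ?S"
    unfolding strength_def using fin by (intro Min_in)
  then show "\<exists>g. numbering G g \<and> strength G = numbering_strength G g"
    by auto
  show "numbering G g \<Longrightarrow> strength G \<le> numbering_strength G g"
    unfolding strength_def using fin by (intro Min_le) auto
qed

end

theory Submission
  imports Defs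
begin

text \<open>
  Reversing a numbering, that is, replacing every value \<open>i\<close> by \<open>n + 1 - i\<close>, turns the sum \<open>s\<close>
  of the values at the ends of an edge into \<open>2 * n + 2 - s\<close>.  So \<open>strength G \<le> 2 * n - k\<close> says that
  some numbering \<open>f\<close> has \<open>f u + f v \<ge> k + 2\<close> on every edge (\<open>strength_le_iff_reversed\<close>), or, in the
  contrapositive: distinct vertices with \<open>f u + f v \<le> k + 1\<close> are adjacent in the complement.

  On the other side, two vertices \<open>i \<noteq> j\<close> of \<open>F_graph k\<close> are adjacent exactly if \<open>i + j \<le> k + 1\<close>
  (\<open>F_graph_arc_iff\<close>).  Hence the vertices numbered \<open>1, \<dots>, k\<close> by \<open>f\<close> carry a copy of \<open>F_graph k\<close> in
  the complement.  Conversely, the vertices of such a copy can be numbered \<open>1, \<dots>, k\<close> as in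
  \<open>F_graph k\<close> and the others arbitrarily by \<open>k + 1, \<dots>, n\<close> (\<open>numbering_extending_embedding\<close>).  A pair
  with sum at most \<open>k + 1\<close> then lies inside the copy, because values are positive, so it is a pair of
  adjacent vertices of the complement.
\<close>

text \<open>
  A copy need not be induced, so the image of \<open>F\<close> under any injective homomorphism is one; the arc
  components of an isomorphism are determined by its vertex map and drop out of the argument.
\<close>
lemma contains_graph_iff_embedding:
  fixes G :: "'a pair_pre_digraph" and F :: "'b pair_pre_digraph"
  assumes "pair_graph G" and "pair_graph F"
  shows "contains_graph G F \<longleftrightarrow>
    (\<exists>\<phi>. inj_on \<phi> (pverts F) \<and> \<phi> ` pverts F \<subseteq> pverts G \<and>
      (\<forall>a b. (a, b) \<in> parcs F \<longrightarrow> (\<phi> a, \<phi> b) \<in> parcs G))"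
proof
  assume "contains_graph G F"
  then obtain H :: "'a pair_pre_digraph" and f
    where sub: "subgraph (with_proj H) (with_proj G)"
      and f: "pre_digraph.digraph_isomorphism (with_proj F) f"
      and H: "with_proj H = app_iso f (with_proj F)"
    unfolding contains_graph_def digraph_iso_def by blast
  have verts: "pverts H = iso_verts f ` pverts F" and arcs: "parcs H = iso_arcs f ` parcs F"
    and ends: "iso_tail f = fst" "iso_head f = snd"
    using arg_cong[OF H, of verts] arg_cong[OF H, of arcs]
      arg_cong[OF H, of tail] arg_cong[OF H, of head] by simp_all
  have "iso_arcs f (a, b) = (iso_verts f a, iso_verts f b)" if "(a, b) \<in> parcs F" for a b
    using f that unfolding pre_digraph.digraph_isomorphism_def ends
    by (auto simp: prod_eq_iff dest!: bspec)
  then have "(iso_verts f a, iso_verts f b) \<in> parcs H" if "(a, b) \<in> parcs F" for a b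
    using that arcs by (metis image_eqI)
  then show "\<exists>\<phi>. inj_on \<phi> (pverts F) \<and> \<phi> ` pverts F \<subseteq> pverts G \<and>
      (\<forall>a b. (a, b) \<in> parcs F \<longrightarrow> (\<phi> a, \<phi> b) \<in> parcs G)"
    using f sub verts unfolding pre_digraph.digraph_isomorphism_def subgraph_def
    by (intro exI[of _ "iso_verts f"]) auto
next
  interpret F: pair_graph F by fact
  interpret G: pair_graph G by fact
  assume "\<exists>\<phi>. inj_on \<phi> (pverts F) \<and> \<phi> ` pverts F \<subseteq> pverts G \<and>
      (\<forall>a b. (a, b) \<in> parcs F \<longrightarrow> (\<phi> a, \<phi> b) \<in> parcs G)"
  then obtain \<phi> where inj: "inj_on \<phi> (pverts F)" and verts: "\<phi> ` pverts F \<subseteq> pverts G"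
    and arcs: "\<And>a b. (a, b) \<in> parcs F \<Longrightarrow> (\<phi> a, \<phi> b) \<in> parcs G"
    by blast
  define H where "H = \<lparr> pverts = \<phi> ` pverts F, parcs = map_prod \<phi> \<phi> ` parcs F \<rparr>"
  have "sym (parcs F)"
    using F.pair_sym_arcs by (simp add: symmetric_def)
  then have "sym (parcs H)"
    by (force simp: H_def intro!: symI dest: symD)
  \<comment> \<open>\<open>H\<close> inherits freedom from loops from \<open>G\<close>, since its arcs are arcs of \<open>G\<close>.\<close>
  then have "pair_graph H"
    by unfold_locales
      (auto simp: H_def symmetric_def F.pair_finite_verts F.pair_finite_arcs
        dest: F.in_arcsD1 F.in_arcsD2 arcs G.pair_no_loops)
  then interpret H: pair_graph H .
  have "subgraph (with_proj H) (with_proj G)"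
    unfolding subgraph_def compatible_def
    using verts arcs H.wf_digraph_axioms G.wf_digraph_axioms by (auto simp: H_def)
  moreover have "parcs F \<subseteq> pverts F \<times> pverts F"
    using F.in_arcsD1 F.in_arcsD2 by auto
  then have "inj_on (map_prod \<phi> \<phi>) (parcs F)"
    using map_prod_inj_on[OF inj inj] inj_on_subset by blast
  then have "digraph_iso (with_proj F) (with_proj H)"
    unfolding digraph_iso_def pre_digraph.digraph_isomorphism_def
    using inj F.wf_digraph_axioms
    by (intro exI[of _ "\<lparr>iso_verts = \<phi>, iso_arcs = map_prod \<phi> \<phi>, iso_head = snd, iso_tail = fst\<rparr>"])
      (auto simp: app_iso_def with_proj_def H_def)
  ultimately show "contains_graph G F"
    unfolding contains_graph_def using \<open>pair_graph H\<close> by blast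
qed

text \<open>
  The bound \<open>i \<le> k div 2\<close> in the definition of \<open>F_graph k\<close> is implied by \<open>i < j\<close> and
  \<open>i + j \<le> k + 1\<close>, which leaves a condition symmetric in \<open>i\<close> and \<open>j\<close>.
\<close>
lemma F_graph_arc_iff:
  "(i, j) \<in> parcs (F_graph k) \<longleftrightarrow> 1 \<le> i \<and> 1 \<le> j \<and> i \<noteq> j \<and> i + j \<le> k + 1"
  unfolding F_graph_def F_edges_def by auto

lemma numbering_reverse:
  assumes "numbering G g"
  shows "numbering G (\<lambda>v. card (pverts G) + 1 - g v)"
proof -
  let ?n = "card (pverts G)"
  have "bij_betw (\<lambda>i. ?n + 1 - i) {1..?n} {1..?n}"
    by (rule bij_betwI[where g = "\<lambda>i. ?n + 1 - i"]) auto
  then have "bij_betw ((\<lambda>i. ?n + 1 - i) \<circ> g) (pverts G) {1..?n}"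
    using assms bij_betw_trans unfolding numbering_def by blast
  then show ?thesis
    by (simp add: numbering_def comp_def)
qed

lemma numbering_bounds:
  assumes "numbering G g" and "v \<in> pverts G"
  shows "1 \<le> g v \<and> g v \<le> card (pverts G)"
  using assms bij_betwE unfolding numbering_def by fastforce

lemma numbering_strength_le_iff:
  assumes "pair_graph G" and "parcs G \<noteq> {}"
  shows "numbering_strength G g \<le> m \<longleftrightarrow> (\<forall>(u, v) \<in> parcs G. g u + g v \<le> m)"
proof -
  interpret pair_graph G by fact
  have "{g u + g v | u v. (u, v) \<in> parcs G} = (\<lambda>(u, v). g u + g v) ` parcs G"
    by auto
  then show ?thesis
    unfolding numbering_strength_def using pair_finite_arcs assms(2) by auto
qed

lemma strength_le_iff:
  assumes "pair_graph G" and "parcs G \<noteq> {}"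
  shows "strength G \<le> m \<longleftrightarrow> (\<exists>g. numbering G g \<and> (\<forall>(u, v) \<in> parcs G. g u + g v \<le> m))"
proof
  assume "strength G \<le> m"
  moreover obtain g where "numbering G g" "strength G = numbering_strength G g"
    using strength_attained(1)[OF assms] by blast
  ultimately show "\<exists>g. numbering G g \<and> (\<forall>(u, v) \<in> parcs G. g u + g v \<le> m)"
    using numbering_strength_le_iff[OF assms, of g m] by auto
next
  assume "\<exists>g. numbering G g \<and> (\<forall>(u, v) \<in> parcs G. g u + g v \<le> m)"
  then obtain g where "numbering G g" "numbering_strength G g \<le> m"
    using numbering_strength_le_iff[OF assms] by blast
  then show "strength G \<le> m"
    using strength_attained(2)[OF assms, of g] by simp
qed

text \<open>
  The hypothesis \<open>k \<le> card (pverts G)\<close> keeps the subtraction of natural numbers exact.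
\<close>
lemma strength_le_iff_reversed:
  assumes "pair_graph G" and "parcs G \<noteq> {}" and "k \<le> card (pverts G)"
  shows "strength G \<le> 2 * card (pverts G) - k \<longleftrightarrow>
    (\<exists>f. numbering G f \<and> (\<forall>(u, v) \<in> parcs G. k + 2 \<le> f u + f v))"
    (is "_ \<longleftrightarrow> (\<exists>f. ?large f)")
proof -
  interpret pair_graph G by fact
  let ?n = "card (pverts G)"
  let ?rev = "\<lambda>g v. ?n + 1 - g v"
  let ?small = "\<lambda>g. numbering G g \<and> (\<forall>(u, v) \<in> parcs G. g u + g v \<le> 2 * ?n - k)"
  have bounds: "1 \<le> g u \<and> g u \<le> ?n \<and> 1 \<le> g v \<and> g v \<le> ?n"
    if "numbering G g" "(u, v) \<in> parcs G" for g u v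
    using that numbering_bounds in_arcsD1 in_arcsD2 by metis
  have "?large (?rev g)" if small: "?small g" for g
  proof -
    have "k + 2 \<le> ?rev g u + ?rev g v" if uv: "(u, v) \<in> parcs G" for u v
    proof -
      have "g u + g v \<le> 2 * ?n - k"
        using small uv by blast
      then show ?thesis
        using bounds[OF _ uv, of g] small assms(3) by linarith
    qed
    then show ?thesis
      using small numbering_reverse[of G g] by blast
  qed
  moreover have "?small (?rev f)" if large: "?large f" for f
  proof -
    have "?rev f u + ?rev f v \<le> 2 * ?n - k" if uv: "(u, v) \<in> parcs G" for u v
    proof -
      have "k + 2 \<le> f u + f v"
        using large uv by blast
      then show ?thesis
        using bounds[OF _ uv, of f] large assms(3) by linarith
    qed
    then show ?thesis
      using large numbering_reverse[of G f] by blast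
  qed
  ultimately show ?thesis
    unfolding strength_le_iff[OF assms(1,2)] by blast
qed

lemma numbering_extending_embedding:
  assumes "finite (pverts G)" and inj: "inj_on \<phi> {1..k}" and img: "\<phi> ` {1..k} \<subseteq> pverts G"
  obtains f where "numbering G f"
    and "\<And>i. i \<in> {1..k} \<Longrightarrow> f (\<phi> i) = i"
    and "\<And>v. v \<in> pverts G - \<phi> ` {1..k} \<Longrightarrow> k < f v"
proof -
  let ?n = "card (pverts G)"
  let ?A = "\<phi> ` {1..k}"
  have card: "card ?A = k"
    using card_image[OF inj] by simp
  then have "k \<le> ?n"
    using card_mono[OF assms(1) img] by simp
  moreover have "card (pverts G - ?A) = card {k+1..?n}"
    using card_Diff_subset[OF _ img] card by simp
  then obtain h where h: "bij_betw h (pverts G - ?A) {k+1..?n}"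
    using finite_same_card_bij[of "pverts G - ?A" "{k+1..?n}"] assms(1) by auto
  define f where "f = (\<lambda>v. if v \<in> ?A then the_inv_into {1..k} \<phi> v else h v)"
  have "bij_betw (the_inv_into {1..k} \<phi>) ?A {1..k}"
    using inj by (simp add: bij_betw_imageI bij_betw_the_inv_into)
  then have "bij_betw f ?A {1..k}"
    by (rule bij_betw_cong[THEN iffD1, rotated]) (simp add: f_def)
  moreover have out: "bij_betw f (pverts G - ?A) {k+1..?n}"
    using h by (rule bij_betw_cong[THEN iffD1, rotated]) (simp add: f_def)
  ultimately have "bij_betw f (?A \<union> (pverts G - ?A)) ({1..k} \<union> {k+1..?n})"
    by (intro bij_betw_combine) auto
  moreover have "?A \<union> (pverts G - ?A) = pverts G" "{1..k} \<union> {k+1..?n} = {1..?n}"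
    using img \<open>k \<le> ?n\<close> by auto
  ultimately have "numbering G f"
    by (simp add: numbering_def)
  moreover have "f (\<phi> i) = i" if "i \<in> {1..k}" for i
    using that inj by (simp add: f_def the_inv_into_f_f)
  moreover have "k < f v" if "v \<in> pverts G - ?A" for v
  proof -
    have "f v \<in> {k+1..?n}"
      using bij_betwE[OF out] \<open>v \<in> pverts G - ?A\<close> by blast
    then show ?thesis
      by simp
  qed
  ultimately show ?thesis
    using that by blast
qed

theorem theorem4p1:
  fixes G :: "'a pair_pre_digraph" and n k :: nat
  assumes "pair_graph G"
    and "parcs G \<noteq> {}"
    and "card (pverts G) = n"
    and "1 \<le> k" and "k \<le> n"
  shows "strength G \<le> 2 * n - k \<longleftrightarrow> contains_graph (complement G) (F_graph k)"
proof -
  interpret pair_graph G by fact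
  have verts: "pverts (complement G) = pverts G" "pverts (F_graph k) = {1..k}"
    by (simp_all add: complement_def F_graph_def)
  have strength: "strength G \<le> 2 * n - k \<longleftrightarrow>
      (\<exists>f. numbering G f \<and> (\<forall>(u, v) \<in> parcs G. k + 2 \<le> f u + f v))"
    using strength_le_iff_reversed assms by blast
  have contains: "contains_graph (complement G) (F_graph k) \<longleftrightarrow>
      (\<exists>\<phi>. inj_on \<phi> {1..k} \<and> \<phi> ` {1..k} \<subseteq> pverts G \<and>
        (\<forall>i j. (i, j) \<in> parcs (F_graph k) \<longrightarrow> (\<phi> i, \<phi> j) \<in> parcs (complement G)))"
    using contains_graph_iff_embedding[OF pair_graph_complement[OF assms(1)] pair_graph_F_graph[of k]]
    unfolding verts .
  show ?thesis
    unfolding strength contains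
  proof
    assume "\<exists>f. numbering G f \<and> (\<forall>(u, v) \<in> parcs G. k + 2 \<le> f u + f v)"
    then obtain f where f: "bij_betw f (pverts G) {1..n}"
      and large: "\<And>u v. (u, v) \<in> parcs G \<Longrightarrow> k + 2 \<le> f u + f v"
      using assms(3) unfolding numbering_def by blast
    define \<phi> where "\<phi> = the_inv_into (pverts G) f"
    have \<phi>: "bij_betw \<phi> {1..n} (pverts G)"
      unfolding \<phi>_def using f by (rule bij_betw_the_inv_into)
    then have inj: "inj_on \<phi> {1..n}"
      by (rule bij_betw_imp_inj_on)
    have in_G: "\<phi> i \<in> pverts G" if "i \<in> {1..n}" for i
      using bij_betwE[OF \<phi>] that by blast
    have f_\<phi>: "f (\<phi> i) = i" if "i \<in> {1..n}" for i
      unfolding \<phi>_def using f that by (rule f_the_inv_into_f_bij_betw)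
    have "(\<phi> i, \<phi> j) \<in> parcs (complement G)" if "(i, j) \<in> parcs (F_graph k)" for i j
    proof -
      have ij: "i \<in> {1..n}" "j \<in> {1..n}" "i \<noteq> j" "i + j \<le> k + 1"
        using that assms(5) by (auto simp: F_graph_arc_iff)
      then have "(\<phi> i, \<phi> j) \<notin> parcs G"
        using large[of "\<phi> i" "\<phi> j"] f_\<phi> by auto
      then show ?thesis
        using ij in_G inj by (auto simp: complement_def dest: inj_onD)
    qed
    moreover have "{1..k} \<subseteq> {1..n}"
      using assms(5) by auto
    then have "inj_on \<phi> {1..k}" "\<phi> ` {1..k} \<subseteq> pverts G"
      using inj in_G inj_on_subset by blast+
    ultimately show "\<exists>\<phi>. inj_on \<phi> {1..k} \<and> \<phi> ` {1..k} \<subseteq> pverts G \<and>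
        (\<forall>i j. (i, j) \<in> parcs (F_graph k) \<longrightarrow> (\<phi> i, \<phi> j) \<in> parcs (complement G))"
      by blast
  next
    assume "\<exists>\<phi>. inj_on \<phi> {1..k} \<and> \<phi> ` {1..k} \<subseteq> pverts G \<and>
        (\<forall>i j. (i, j) \<in> parcs (F_graph k) \<longrightarrow> (\<phi> i, \<phi> j) \<in> parcs (complement G))"
    then obtain \<phi> where \<phi>: "inj_on \<phi> {1..k}" "\<phi> ` {1..k} \<subseteq> pverts G"
      and arcs: "\<And>i j. (i, j) \<in> parcs (F_graph k) \<Longrightarrow> (\<phi> i, \<phi> j) \<in> parcs (complement G)"
      by blast
    obtain f where f: "numbering G f"
      and f_\<phi>: "\<And>i. i \<in> {1..k} \<Longrightarrow> f (\<phi> i) = i"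
      and f_out: "\<And>v. v \<in> pverts G - \<phi> ` {1..k} \<Longrightarrow> k < f v"
      using numbering_extending_embedding[OF pair_finite_verts \<phi>] by blast
    have "k + 2 \<le> f u + f v" if uv: "(u, v) \<in> parcs G" for u v
    proof (rule ccontr)
      assume "\<not> k + 2 \<le> f u + f v"
      moreover have in_G: "u \<in> pverts G" "v \<in> pverts G"
        using uv in_arcsD1 in_arcsD2 by blast+
      then have pos: "1 \<le> f u" "1 \<le> f v"
        using numbering_bounds[OF f] by blast+
      ultimately have le: "f u + f v \<le> k + 1" "f u \<le> k" "f v \<le> k"
        by auto
      then have "u \<in> \<phi> ` {1..k}" "v \<in> \<phi> ` {1..k}"
        using f_out in_G by fastforce+
      then obtain i j where ij: "i \<in> {1..k}" "j \<in> {1..k}" "u = \<phi> i" "v = \<phi> j"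
        by blast
      moreover have "u \<noteq> v"
        using pair_no_loops[OF uv] by simp
      ultimately have "(i, j) \<in> parcs (F_graph k)"
        using le f_\<phi> by (auto simp: F_graph_arc_iff)
      then have "(u, v) \<notin> parcs G"
        using arcs ij by (auto simp: complement_def)
      then show False
        using uv by contradiction
    qed
    then show "\<exists>f. numbering G f \<and> (\<forall>(u, v) \<in> parcs G. k + 2 \<le> f u + f v)"
      using f by blast
  qed
qed

end
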